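(* Let $n\in\mathbb{N}$, $n \ge 1$, and let $\lambda > -1/2$ be a real number such that the ultraspherical polynomials $C_{n+1}^{(\lambda+1)}(x)$ and $C_n^{(\lambda)}(x)$ have no common zeros. Let $-1 < w_1 < w_2 < \dots < w_n < w_{n+1} < 1$ be the zeros of $C_{n+1}^{(\lambda+1)}(x)$ in increasing order, and let $$k_n = \sqrt{\frac{n+2\lambda+1}{2n+2\lambda+2}}.$$ Then each of the $n+2$ open intervals $(-1,w_1), (w_1,w_2), \dots, (w_{n-1},w_n), (w_n,w_{n+1}), (w_{n+1},1)$ contains either exactly one simple zero of $C_n^{(\lambda)}(x)$ or the point $k_n$ or $-k_n$, but not both (that is, not both a zero of $C_n^{(\lambda)}(x)$ and one of the points $\pm k_n$). Moreover, the zeros of $C_n^{(\lambda)}(x)$ and $C_{n+1}^{(\lambda+1)}(x)$ are interlacing if and only if $-1 < -k_n < w_1$ or, equivalently, $w_{n+1} < k_n < 1$.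
   Context: For $\lambda > -1/2$, $\{C_n^{(\lambda)}(x)\}_{n=0}^\infty$ denotes the sequence of ultraspherical (Gegenbauer) polynomials, i.e. the symmetric case $\alpha=\beta=\lambda-1/2$ of the Jacobi polynomials $P_n^{(\alpha,\beta)}$: up to a nonzero normalization constant (which does not affect zeros), $C_n^{(\lambda)}$ is the degree-$n$ polynomial in the sequence orthogonal on $(-1,1)$ with respect to the weight $(1-x^2)^{\lambda-1/2}$. Its $n$ zeros are real, distinct, symmetric about the origin and lie in $(-1,1)$. The zeros of a polynomial $p$ of degree $n$ and a polynomial $q$ of degree $n+1$, both with real simple zeros, are said to be interlacing if between each pair of consecutive zeros of $q$ there is (strictly) exactly one zero of $p$. *)

theory Defs
  imports "HOL-Analysis.Analysis" "HOL-Computational_Algebra.Polynomial"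
begin

(* The normalization is left free: the classical one degenerates at l = 0, where
   C_n vanishes identically for n >= 1. For l > -1/2 every integral below converges. *)
definition ultraspherical_seq :: "real \<Rightarrow> (nat \<Rightarrow> real poly) \<Rightarrow> bool" where
  "ultraspherical_seq l C \<longleftrightarrow>
     (\<forall>n. C n \<noteq> 0 \<and> degree (C n) = n) \<and>
     (\<forall>m n. m \<noteq> n \<longrightarrow>
        (LINT x:{-1<..<1}|lborel. poly (C m) x * poly (C n) x * (1 - x^2) powr (l - 1/2)) = 0)"

definition real_simple_zeros :: "real poly \<Rightarrow> bool" where
  "real_simple_zeros p \<longleftrightarrow> p \<noteq> 0 \<and>
     (\<forall>z. poly (map_poly complex_of_real p) z = 0 \<longrightarrow>
        z \<in> \<real> \<and> order z (map_poly complex_of_real p) = 1)"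

definition consecutive_zeros :: "real poly \<Rightarrow> real \<Rightarrow> real \<Rightarrow> bool" where
  "consecutive_zeros q a b \<longleftrightarrow> a < b \<and> poly q a = 0 \<and> poly q b = 0 \<and>
     (\<forall>x\<in>{a<..<b}. poly q x \<noteq> 0)"

definition interlacing :: "real poly \<Rightarrow> real poly \<Rightarrow> bool" where
  "interlacing p q \<longleftrightarrow> degree q = degree p + 1 \<and> real_simple_zeros p \<and> real_simple_zeros q \<and>
     (\<forall>a b. consecutive_zeros q a b \<longrightarrow> (\<exists>!x. x \<in> {a<..<b} \<and> poly p x = 0))"

end

theory Submission
  imports Defs
begin

text \<open>
  Write \<open>p\<close> for the ultraspherical polynomial of degree \<open>n\<close> with parameter \<open>l\<close>, and \<open>y\<close> for the one
  of degree \<open>n + 1\<close> with parameter \<open>l + 1\<close>. The theorem rests on one identity: up to a nonzero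
  factor, \<open>p\<close> is
  \<open>(x^2 - k^2) ((1 - x^2) y' + (n + 1) x y) - ((n + 1) (n + 2 l + 2) / (2 n + 2 l + 2)) x y\<close>.
  At a zero \<open>v\<close> of \<open>y\<close> it says that \<open>p(v)\<close> has, up to a fixed sign, the sign of
  \<open>(v^2 - k^2) y'(v)\<close>. Since \<open>y'\<close> alternates in sign along the zeros of \<open>y\<close>, the polynomial \<open>p\<close>
  changes sign between two consecutive zeros of \<open>y\<close> as long as neither \<open>k\<close> nor \<open>-k\<close> separates them.
  The endpoints \<open>-1\<close> and \<open>1\<close> fit into the same pattern once \<open>y\<close> is replaced by \<open>Y = (x^2 - 1) y\<close>,
  whose zeros are exactly the end points of the \<open>n + 2\<close> intervals: the rule
  that \<open>p(v)\<close> is a fixed nonzero constant times a positive number times \<open>(v^2 - k^2) Y'(v)\<close> holds at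
  all of them (\<open>lowering_at_zero\<close>).

  The rest is counting (\<open>zeros_of_grid_sign_pattern\<close>). The points \<open>k\<close> and \<open>-k\<close> lie in at most two of
  the \<open>n + 2\<close> intervals and every other interval contains a zero of \<open>p\<close>. As \<open>p\<close> has only \<open>n\<close> zeros,
  \<open>k\<close> and \<open>-k\<close> lie in two different intervals, each remaining interval contains exactly one zero,
  all of these are simple, and there are no others. Interlacing means that the \<open>n\<close> inner intervals
  are the ones with a zero, that is, that \<open>k\<close> and \<open>-k\<close> lie in the two outer ones; by the symmetry
  of the zeros of \<open>y\<close> it is enough that one of them does.

  The identity is proved through the Gegenbauer differential equation. Integration by parts
  (\<open>pearson_identity\<close>) makes the Gegenbauer operator symmetric for the weighted integral, so
  orthogonality forces \<open>p\<close> and \<open>y\<close> to be eigenfunctions (\<open>ultraspherical_solves_gegenbauer\<close>).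
  Polynomial solutions of the equation are unique up to a factor (\<open>solves_gegenbauer_unique\<close>), and
  the right-hand side of the identity solves the equation of \<open>p\<close> whenever \<open>y\<close> solves its own
  (\<open>solves_gegenbauer_lowering\<close>).
\<close>

section \<open>The weighted integral\<close>

definition weighted_integral :: "real \<Rightarrow> real poly \<Rightarrow> real" where
  "weighted_integral l f = (LINT x:{-1<..<1}|lborel. poly f x * (1 - x^2) powr (l - 1/2))"

text \<open>
  The substitution \<open>t = (1 + x) / 2\<close> turns the weight into a Beta integrand, because
  \<open>1 - x^2 = 4 t (1 - t)\<close>.
\<close>

lemma integrable_weight:
  assumes "l > -1/2"
  shows "set_integrable lborel {-1<..<1} (\<lambda>x::real. (1 - x^2) powr (l - 1/2))"
proof -
  let ?g = "\<lambda>t::real. t powr (l + 1/2 - 1) * (1 - t) powr (l + 1/2 - 1)"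
  have "set_integrable lborel {0..1} ?g"
    using integrable_Beta[of "l + 1/2" "l + 1/2"] assms by simp
  then have "integrable lborel (\<lambda>t. indicator {0..1} t *\<^sub>R ?g t)"
    by (simp add: set_integrable_def)
  then have "integrable lborel (\<lambda>x. indicator {0..1} (1/2 + 1/2 * x) *\<^sub>R ?g (1/2 + 1/2 * x))"
    by (rule lborel_integrable_real_affine) simp
  moreover have "indicator {0..1} (1/2 + 1/2 * x) = (indicator {-1..1} x :: real)" for x :: real
    by (auto simp: indicator_def)
  ultimately have "set_integrable lborel {-1..1} (\<lambda>x. ?g (1/2 + 1/2 * x))"
    by (simp add: set_integrable_def)
  then have "set_integrable lborel {-1..1} (\<lambda>x. 4 powr (l - 1/2) * ?g (1/2 + 1/2 * x))"
    by (intro set_integrable_mult_right) auto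
  then have "set_integrable lborel {-1<..<1} (\<lambda>x. 4 powr (l - 1/2) * ?g (1/2 + 1/2 * x))"
    by (rule set_integrable_subset) auto
  also have "?this \<longleftrightarrow> ?thesis"
  proof (rule set_integrable_cong[OF refl refl])
    fix x :: real assume x: "x \<in> {-1<..<1}"
    have "4 powr (l - 1/2) * ?g (1/2 + 1/2 * x) =
        (4 * ((1/2 + 1/2 * x) * (1 - (1/2 + 1/2 * x)))) powr (l - 1/2)"
      using x powr_mult[of "1/2 + 1/2 * x" "1 - (1/2 + 1/2 * x)" "l - 1/2"]
        powr_mult[of 4 "(1/2 + 1/2 * x) * (1 - (1/2 + 1/2 * x))" "l - 1/2"]
      by (simp del: distrib_left_numeral)
    also have "4 * ((1/2 + 1/2 * x) * (1 - (1/2 + 1/2 * x))) = 1 - x^2"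
      by (simp add: field_simps power2_eq_square)
    finally show "4 powr (l - 1/2) * ?g (1/2 + 1/2 * x) = (1 - x^2) powr (l - 1/2)" .
  qed
  finally show ?thesis .
qed

lemma integrable_poly_weight:
  fixes l :: real
  assumes "l > -1/2"
  shows "set_integrable lborel {-1<..<1} (\<lambda>x. poly f x * (1 - x^2) powr (l - 1/2))"
proof -
  have "compact (poly f ` {-1..1})"
    by (intro compact_continuous_image continuous_intros) auto
  then obtain B where B: "\<And>x. x \<in> {-1..1} \<Longrightarrow> norm (poly f x) \<le> B"
    by (meson bounded_iff compact_imp_bounded imageI)
  have "set_integrable lborel {-1<..<1} (\<lambda>x::real. B * (1 - x^2) powr (l - 1/2))"
    by (intro set_integrable_mult_right integrable_weight assms)
  then show ?thesis
  proof (rule set_integrable_bound)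
    have [measurable]: "poly f \<in> borel_measurable borel"
      by (intro borel_measurable_continuous_onI continuous_intros)
    show "set_borel_measurable lborel {-1<..<1} (\<lambda>x. poly f x * (1 - x^2) powr (l - 1/2))"
      unfolding set_borel_measurable_def powr_def by measurable
    have "norm (poly f x * (1 - x^2) powr (l - 1/2)) \<le> norm (B * (1 - x^2) powr (l - 1/2))"
      if "x \<in> {-1<..<1}" for x
      using B[of x] that by (auto simp: abs_mult intro!: mult_right_mono)
    then show "AE x in lborel. x \<in> {-1<..<1} \<longrightarrow>
        norm (poly f x * (1 - x^2) powr (l - 1/2)) \<le> norm (B * (1 - x^2) powr (l - 1/2))"
      by simp
  qed
qed

lemma weighted_integral_add:
  "l > -1/2 \<Longrightarrow> weighted_integral l (f + g) = weighted_integral l f + weighted_integral l g"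
  unfolding weighted_integral_def
  by (simp add: distrib_right set_integral_add integrable_poly_weight)

lemma weighted_integral_smult:
  "weighted_integral l (smult c f) = c * weighted_integral l f"
  unfolding weighted_integral_def by (simp add: mult.assoc)

lemma weighted_integral_diff:
  "l > -1/2 \<Longrightarrow> weighted_integral l (f - g) = weighted_integral l f - weighted_integral l g"
  using weighted_integral_add[of l f "smult (-1) g"] weighted_integral_smult[of l "-1" g] by simp

text \<open>
  Definiteness: a nonzero polynomial vanishes only on a finite set, so its square cannot integrate
  to zero against a weight that is positive on the whole interval.
\<close>

lemma weighted_integral_square_eq_0:
  assumes "l > -1/2" and "weighted_integral l (f * f) = 0"
  shows "f = 0"
proof (rule ccontr)
  assume "f \<noteq> 0"
  let ?g = "\<lambda>x. indicator {-1<..<1} x *\<^sub>R (poly (f * f) x * (1 - x^2) powr (l - 1/2))"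
  have "integrable lborel ?g"
    using integrable_poly_weight[OF assms(1), of "f * f"] by (simp add: set_integrable_def)
  moreover have "integral\<^sup>L lborel ?g = 0"
    using assms(2) by (simp add: weighted_integral_def set_lebesgue_integral_def)
  ultimately have "AE x in lborel. ?g x = 0"
    by (subst (asm) integral_nonneg_eq_0_iff_AE) (auto intro!: AE_I2)
  then have "AE x in lborel. x \<in> {-1<..<1} \<longrightarrow> poly f x = 0"
  proof (rule AE_mp, intro AE_I2 impI)
    fix x :: real assume "?g x = 0" "x \<in> {-1<..<1}"
    moreover from this have "x\<^sup>2 < 1" by (simp add: power2_less_1_iff abs_square_less_1 abs_less_iff)
    ultimately show "poly f x = 0" by auto
  qed
  moreover have "AE x in lborel. x \<notin> {x. poly f x = 0}"
    by (intro AE_not_in finite_imp_null_set_lborel poly_roots_finite \<open>f \<noteq> 0\<close>)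
  ultimately have "AE x in lborel. x \<notin> {-1<..<1::real}" by eventually_elim auto
  then have "{-1<..<1::real} \<in> null_sets lborel" by (simp add: AE_iff_null_sets)
  then show False by (simp add: null_sets_def)
qed

text \<open>
  The integrand is the derivative of \<open>(1 - x^2) powr (l + 1/2) * f\<close>, and this function vanishes
  at both endpoints because \<open>l + 1/2 > 0\<close>. The symmetry of the Gegenbauer operator
  comes from this identity.
\<close>

lemma pearson_identity:
  assumes l: "l > -1/2"
  shows "weighted_integral l ([:1, 0, -1:] * pderiv f - smult (2 * l + 1) ([:0, 1:] * f)) = 0"
proof -
  let ?h = "[:1, 0, -1:] * pderiv f - smult (2 * l + 1) ([:0, 1:] * f)"
  let ?F = "\<lambda>x. poly f x * (1 - x^2) powr (l + 1/2)"
  have "((\<lambda>x. poly ?h x * (1 - x^2) powr (l - 1/2)) has_integral ?F 1 - ?F (-1)) {-1..1}"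
  proof (rule fundamental_theorem_of_calculus_interior)
    show "continuous_on {-1..1} ?F"
      using l by (intro continuous_intros continuous_on_powr') (auto simp: abs_square_le_1)
    fix x :: real assume "x \<in> {-1<..<1}"
    then have pos: "1 - x^2 > 0" by (simp add: abs_square_less_1 abs_less_iff)
    have split: "(1 - x^2) powr (l + 1/2) = (1 - x^2) * (1 - x^2) powr (l - 1/2)"
      using pos powr_add[of "1 - x^2" 1 "l - 1/2"] by (simp add: add.commute)
    have "(?F has_real_derivative poly (pderiv f) x * (1 - x^2) powr (l + 1/2) +
        poly f x * ((l + 1/2) * (1 - x^2) powr (l + 1/2 - 1) * (- (2 * x)))) (at x)"
      using pos by (auto intro!: derivative_eq_intros poly_DERIV)
    also have "poly (pderiv f) x * (1 - x^2) powr (l + 1/2) +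
        poly f x * ((l + 1/2) * (1 - x^2) powr (l + 1/2 - 1) * (- (2 * x))) =
        poly ?h x * (1 - x^2) powr (l - 1/2)"
      unfolding split by (simp add: algebra_simps power2_eq_square)
    finally show "(?F has_vector_derivative poly ?h x * (1 - x^2) powr (l - 1/2)) (at x)"
      by (simp add: has_real_derivative_iff_has_vector_derivative)
  qed simp
  then have "integral {-1<..<1} (\<lambda>x. poly ?h x * (1 - x^2) powr (l - 1/2)) = 0"
    using l unfolding has_integral_Icc_iff_Ioo by (simp add: has_integral_iff)
  then show ?thesis
    unfolding weighted_integral_def
    by (subst set_borel_integral_eq_integral(2)[OF integrable_poly_weight[OF l]])
qed

section \<open>The Gegenbauer differential equation\<close>

definition gegenbauer_operator :: "real \<Rightarrow> real poly \<Rightarrow> real poly" where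
  "gegenbauer_operator l p =
     [:1, 0, -1:] * pderiv (pderiv p) - smult (2 * l + 1) ([:0, 1:] * pderiv p)"

definition solves_gegenbauer :: "real \<Rightarrow> nat \<Rightarrow> real poly \<Rightarrow> bool" where
  "solves_gegenbauer l n p \<longleftrightarrow>
     gegenbauer_operator l p + smult (real n * (real n + 2 * l)) p = 0"

text \<open>
  The operator is triangular on coefficients, with diagonal entries \<open>- j (j + 2 l)\<close>; these are its
  only possible eigenvalues on polynomials.
\<close>

lemma coeff_gegenbauer_operator:
  "coeff (gegenbauer_operator l p) j =
     real (j + 2) * real (j + 1) * coeff p (j + 2) - real j * (real j + 2 * l) * coeff p j"
proof -
  have "[:1, 0, -1:] * q = q - pCons 0 (pCons 0 q)" for q :: "real poly"
    by simp
  then show ?thesis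
    by (auto simp: gegenbauer_operator_def coeff_pderiv coeff_pCons algebra_simps numeral_2_eq_2
        split: nat.split)
qed

text \<open>
  Comparing leading coefficients shows that the eigenvalue belonging to \<open>n\<close> coincides with the one
  belonging to the degree \<open>d\<close>, that is, \<open>(n - d) (n + d + 2 l) = 0\<close>. The second factor is positive
  when \<open>n\<close> and \<open>d\<close> differ, since then \<open>n + d \<ge> 1 > - 2 l\<close>.
\<close>

lemma degree_solves_gegenbauer:
  assumes "l > -1/2" and "solves_gegenbauer l n p" and "p \<noteq> 0"
  shows "degree p = n"
proof -
  let ?d = "degree p"
  have "coeff (gegenbauer_operator l p + smult (real n * (real n + 2 * l)) p) ?d = 0"
    using assms(2) by (simp add: solves_gegenbauer_def)
  then have "(real n * (real n + 2 * l) - real ?d * (real ?d + 2 * l)) * lead_coeff p = 0"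
    by (simp add: coeff_gegenbauer_operator coeff_eq_0 algebra_simps)
  then have "real n * (real n + 2 * l) - real ?d * (real ?d + 2 * l) = 0"
    using assms(3) by (simp only: mult_eq_0_iff leading_coeff_0_iff) simp
  then have "(real n - real ?d) * (real n + real ?d + 2 * l) = 0"
    by (simp add: algebra_simps)
  moreover have "real n + real ?d + 2 * l \<noteq> 0" if "n \<noteq> ?d"
  proof -
    have "real n + real ?d \<ge> 1" using that by linarith
    then show ?thesis using assms(1) by linarith
  qed
  ultimately show ?thesis by auto
qed

lemma solves_gegenbauer_iff_coeff:
  "solves_gegenbauer l n p \<longleftrightarrow>
     (\<forall>j. real (j + 2) * real (j + 1) * coeff p (j + 2) =
          (real j * (real j + 2 * l) - real n * (real n + 2 * l)) * coeff p j)"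
proof -
  have "coeff (gegenbauer_operator l p + smult (real n * (real n + 2 * l)) p) j =
      real (j + 2) * real (j + 1) * coeff p (j + 2) -
      (real j * (real j + 2 * l) - real n * (real n + 2 * l)) * coeff p j" for j
    by (simp add: coeff_gegenbauer_operator algebra_simps)
  then show ?thesis
    unfolding solves_gegenbauer_def poly_eq_iff by simp
qed

text \<open>
  Cancelling the coefficient of degree \<open>n\<close> leaves a solution whose degree is not \<open>n\<close>, hence zero.
\<close>

lemma solves_gegenbauer_unique:
  assumes "l > -1/2" and "solves_gegenbauer l n p" and "solves_gegenbauer l n q" and "q \<noteq> 0"
  shows "\<exists>c. p = smult c q"
proof -
  define c where "c = coeff p n / coeff q n"
  have dq: "degree q = n" by (rule degree_solves_gegenbauer) (use assms in auto)
  have "solves_gegenbauer l n (p - smult c q)"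
    unfolding solves_gegenbauer_iff_coeff
  proof
    fix j
    have "A * (u - c * v) = B * (u' - c * v')" if "A * u = B * u'" "A * v = B * v'"
      for A B u v u' v' :: real
      using that by algebra
    then show "real (j + 2) * real (j + 1) * coeff (p - smult c q) (j + 2) =
        (real j * (real j + 2 * l) - real n * (real n + 2 * l)) * coeff (p - smult c q) j"
      using assms(2,3) unfolding solves_gegenbauer_iff_coeff coeff_diff coeff_smult by blast
  qed
  moreover have "coeff (p - smult c q) n = 0"
    using assms(4) dq by (auto simp: c_def)
  ultimately have "p - smult c q = 0"
    using degree_solves_gegenbauer[OF assms(1)] leading_coeff_0_iff by metis
  then show ?thesis by auto
qed

text \<open>
  The difference of the two integrands is the Pearson expression of the Wronskian
  \<open>p' q - p q'\<close>.
\<close>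

lemma gegenbauer_operator_symmetric:
  assumes "l > -1/2"
  shows "weighted_integral l (gegenbauer_operator l p * q) =
         weighted_integral l (p * gegenbauer_operator l q)"
proof -
  let ?f = "pderiv p * q - p * pderiv q"
  have "[:1, 0, -1:] * pderiv ?f - smult (2 * l + 1) ([:0, 1:] * ?f) =
      gegenbauer_operator l p * q - p * gegenbauer_operator l q"
    by (rule poly_eq_poly_eq_iff[THEN iffD1], rule ext)
      (simp add: gegenbauer_operator_def pderiv_diff pderiv_mult algebra_simps)
  then show ?thesis
    using pearson_identity[OF assms, of ?f] weighted_integral_diff[OF assms] by simp
qed

text \<open>
  The members of index below \<open>n\<close> have every degree below \<open>n\<close>, so they span the polynomials of
  smaller degree; the induction removes one leading coefficient at a time.
\<close>

lemma ultraspherical_orthogonal_lower: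
  assumes l: "l > -1/2" and C: "ultraspherical_seq l C"
    and g: "\<And>j. j \<ge> n \<Longrightarrow> coeff g j = 0"
  shows "weighted_integral l (C n * g) = 0"
proof -
  have "weighted_integral l (C n * h) = 0" if "m \<le> n" "\<And>j. j \<ge> m \<Longrightarrow> coeff h j = 0" for m h
    using that
  proof (induction m arbitrary: h)
    case 0
    then have "h = 0" by (intro poly_eqI) simp
    then show ?case by (simp add: weighted_integral_def)
  next
    case (Suc m)
    define a where "a = coeff h m / coeff (C m) m"
    have Cm: "degree (C m) = m" "C m \<noteq> 0"
      using C by (auto simp: ultraspherical_seq_def)
    then have lc: "coeff (C m) m \<noteq> 0"
      by (metis leading_coeff_0_iff)
    have "weighted_integral l (C n * (h - smult a (C m))) = 0"
    proof (rule Suc.IH)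
      fix j assume "m \<le> j"
      then show "coeff (h - smult a (C m)) j = 0"
        using Suc.prems(2)[of j] lc Cm by (cases "j = m") (auto simp: a_def coeff_eq_0)
    qed (use Suc.prems in simp)
    moreover have "weighted_integral l (C n * C m) = 0"
      using C Suc.prems(1) by (auto simp: ultraspherical_seq_def weighted_integral_def)
    ultimately show ?case
      by (simp add: right_diff_distrib weighted_integral_diff[OF l] weighted_integral_smult)
  qed
  from this[of n g] g show ?thesis by simp
qed

text \<open>
  Let \<open>s\<close> be the left-hand side of the differential equation. Its degree is below \<open>n\<close>, because
  the leading terms cancel. By symmetry of the operator, \<open>s\<close> is orthogonal to everything of degree
  below \<open>n\<close>, in particular to itself.
\<close>

lemma ultraspherical_solves_gegenbauer:
  assumes l: "l > -1/2" and C: "ultraspherical_seq l C"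
  shows "solves_gegenbauer l n (C n)"
proof -
  let ?b = "real n * (real n + 2 * l)"
  define s where "s = gegenbauer_operator l (C n) + smult ?b (C n)"
  have "degree (C n) = n"
    using C by (simp add: ultraspherical_seq_def)
  then have s0: "coeff s j = 0" if "j \<ge> n" for j
    using that by (cases "j = n") (auto simp: s_def coeff_gegenbauer_operator coeff_eq_0)
  then have "coeff (gegenbauer_operator l s) j = 0" if "j \<ge> n" for j
    using that by (simp add: coeff_gegenbauer_operator)
  then have "weighted_integral l (C n * gegenbauer_operator l s) = 0"
    by (rule ultraspherical_orthogonal_lower[OF l C])
  moreover have "weighted_integral l (C n * s) = 0"
    by (rule ultraspherical_orthogonal_lower[OF l C s0])
  moreover have "s * s = gegenbauer_operator l (C n) * s + smult ?b (C n * s)"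
    by (subst (1) s_def) (simp add: distrib_right)
  ultimately have "weighted_integral l (s * s) = 0"
    by (simp add: weighted_integral_add[OF l] weighted_integral_smult
        gegenbauer_operator_symmetric[OF l])
  then have "s = 0" by (rule weighted_integral_square_eq_0[OF l])
  then show ?thesis by (simp add: solves_gegenbauer_def s_def)
qed

lemma solves_gegenbauer_pointwise:
  assumes "solves_gegenbauer l n p"
  shows "(1 - x^2) * poly (pderiv (pderiv p)) x - (2 * l + 1) * x * poly (pderiv p) x +
         real n * (real n + 2 * l) * poly p x = 0"
proof -
  have "poly (gegenbauer_operator l p + smult (real n * (real n + 2 * l)) p) x = 0"
    using assms by (simp add: solves_gegenbauer_def)
  then show ?thesis
    by (simp add: gegenbauer_operator_def algebra_simps power2_eq_square)
qed

lemma solves_gegenbauer_reflect: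
  "solves_gegenbauer l n p \<Longrightarrow> solves_gegenbauer l n (pcompose p [:0, -1:])"
  by (simp add: solves_gegenbauer_iff_coeff coeff_pcompose_linear mult.left_commute)

text \<open>
  Reflection preserves the differential equation, so by uniqueness \<open>p (- x)\<close> is a multiple of
  \<open>p x\<close>.
\<close>

lemma solves_gegenbauer_zeros_symmetric:
  assumes "l > -1/2" and "solves_gegenbauer l n p" and "poly p x = 0"
  shows "poly p (- x) = 0"
proof (cases "p = 0")
  case False
  then obtain c where "pcompose p [:0, -1:] = smult c p"
    using solves_gegenbauer_unique[OF assms(1)] solves_gegenbauer_reflect assms(2) by blast
  then have "poly (pcompose p [:0, -1:]) x = 0"
    using assms(3) by simp
  then show ?thesis by (simp add: poly_pcompose)
qed simp

section \<open>The operator lowering degree and parameter\<close>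

text \<open>
  A first-order differential operator taking solutions with parameters \<open>l + 1\<close> and \<open>n + 1\<close> to
  solutions with parameters \<open>l\<close> and \<open>n\<close>. It is the expression for \<open>p\<close> in the introduction with
  denominators cleared, so the quadratic factor is \<open>2n + 2l + 2\<close> times \<open>x^2 - k^2\<close>. The factor
  \<open>(1 - x^2) y' + (n + 1) x y\<close>, with \<open>y\<close> as there, is a multiple of the ultraspherical polynomial
  of degree \<open>n\<close> with parameter \<open>l + 1\<close>. For \<open>n \<ge> 2\<close> the remaining terms come from combining the
  three-term recurrence with the relation that writes \<open>p\<close> through the polynomials of degrees \<open>n\<close>
  and \<open>n - 2\<close> with parameter \<open>l + 1\<close>; the resulting formula holds for \<open>n = 1\<close> as well.
\<close>

definition lowering :: "real \<Rightarrow> nat \<Rightarrow> real poly \<Rightarrow> real poly" where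
  "lowering l n y =
     (let d = 2 * real n + 2 * l + 2; m = real n + 1
      in [:-(real n + 2 * l + 1), 0, d:] * ([:1, 0, -1:] * pderiv y + [:0, m:] * y)
           - smult (m * (real n + 2 * l + 2)) ([:0, 1:] * y))"

lemma poly_lowering:
  "poly (lowering l n y) x =
     ((2 * real n + 2 * l + 2) * x^2 - (real n + 2 * l + 1)) *
       ((1 - x^2) * poly (pderiv y) x + (real n + 1) * x * poly y x)
     - (real n + 1) * (real n + 2 * l + 2) * x * poly y x"
  by (simp add: lowering_def Let_def algebra_simps power2_eq_square)

text \<open>
  The equation for the image involves \<open>y\<close> and its first three derivatives. It is a combination,
  with polynomial coefficients, of the equation for \<open>y\<close> and the derivative of that equation.
\<close>

lemma solves_gegenbauer_lowering:
  assumes "solves_gegenbauer (l + 1) (n + 1) y"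
  shows "solves_gegenbauer l n (lowering l n y)"
proof -
  have *: "gegenbauer_operator (l + 1) y + smult (real (n + 1) * (real (n + 1) + 2 * (l + 1))) y = 0"
    using assms by (simp add: solves_gegenbauer_def)
  from arg_cong[OF this, of pderiv]
  have **: "pderiv (gegenbauer_operator (l + 1) y +
      smult (real (n + 1) * (real (n + 1) + 2 * (l + 1))) y) = 0"
    by simp
  have "poly (gegenbauer_operator l (lowering l n y) +
      smult (real n * (real n + 2 * l)) (lowering l n y)) x = 0" for x
  proof -
    define m d N Y0 Y1 Y2 Y3 where "m = real n" and "d = 2 * real n + 2 * l + 2"
      and "N = real n + 2 * l + 1"
      and "Y0 = poly y x" and "Y1 = poly (pderiv y) x"
      and "Y2 = poly (pderiv (pderiv y)) x" and "Y3 = poly (pderiv (pderiv (pderiv y))) x"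
    (* N, d and f abbreviate the coefficients of the operator; P and Q are the equation for y and
       its derivative. The multiplier of Q is fixed by the terms in Y3, that of P by those in Y2. *)
    define f where "f = d * x^2 - N"
    define G where "G = (m + 1) * x * f - (m + 1) * (N + 1) * x"
    define P where "P = (1 - x^2) * Y2 - (2 * l + 3) * x * Y1 + (m + 1) * (m + 2 * l + 3) * Y0"
    define Q where "Q = (1 - x^2) * Y3 - (2 * l + 5) * x * Y2 +
        ((m + 1) * (m + 2 * l + 3) - (2 * l + 3)) * Y1"
    have "P = 0"
      using arg_cong[OF *, of "\<lambda>p. poly p x"]
      unfolding P_def gegenbauer_operator_def Y0_def Y1_def Y2_def m_def
      by (simp add: algebra_simps power2_eq_square)
    moreover have "Q = 0"
      using arg_cong[OF **, of "\<lambda>p. poly p x"]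
      unfolding Q_def gegenbauer_operator_def Y0_def Y1_def Y2_def Y3_def m_def
      by (simp add: algebra_simps power2_eq_square pderiv_add pderiv_diff pderiv_smult pderiv_mult pderiv_pCons pderiv_minus)
    moreover have "poly (gegenbauer_operator l (lowering l n y) +
        smult (real n * (real n + 2 * l)) (lowering l n y)) x =
        (4 * d * x * (1 - x^2) + G) * P + f * (1 - x^2) * Q"
      unfolding gegenbauer_operator_def lowering_def Let_def f_def G_def P_def Q_def N_def d_def
      by (simp add: pderiv_add pderiv_diff pderiv_smult pderiv_mult pderiv_pCons pderiv_minus
          flip: Y0_def Y1_def Y2_def Y3_def m_def, algebra)
    ultimately show ?thesis by simp
  qed
  then show ?thesis
    unfolding solves_gegenbauer_def by (intro poly_eq_poly_eq_iff[THEN iffD1] ext) simp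
qed

text \<open>
  At a zero of \<open>y\<close> only the term \<open>(x^2 - k^2) (1 - x^2) y'\<close> of the image survives, and
  \<open>(1 - x^2) y'\<close> is minus the derivative of \<open>(x^2 - 1) y\<close>. At \<open>x = 1\<close> and \<open>x = -1\<close> the image and
  that derivative are both multiples of \<open>x y\<close>; the special value of \<open>k\<close> and the assumption
  \<open>l > - 1/2\<close> give the ratio the same sign as at the zeros of \<open>y\<close>.
\<close>

lemma lowering_at_zero:
  assumes l: "l > -1/2" and zero: "poly ([:-1, 0, 1:] * y) x = 0"
    and k: "k^2 = (real n + 2 * l + 1) / (2 * real n + 2 * l + 2)"
  shows "\<exists>t>0. poly (lowering l n y) x =
           - t * (x^2 - k^2) * poly (pderiv ([:-1, 0, 1:] * y)) x"
proof -
  define d where "d = 2 * real n + 2 * l + 2"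
  have d: "d > 0" using l by (simp add: d_def)
  have dk: "d * k^2 = real n + 2 * l + 1" using d k by (simp add: d_def)
  have Y': "poly (pderiv ([:-1, 0, 1:] * y)) x = (x^2 - 1) * poly (pderiv y) x + 2 * x * poly y x"
    by (simp add: pderiv_mult pderiv_pCons pderiv_diff algebra_simps power2_eq_square
        del: mult_pCons_left)
  have r: "poly (lowering l n y) x =
      (d * x^2 - d * k^2) * ((1 - x^2) * poly (pderiv y) x + (real n + 1) * x * poly y x)
      - (real n + 1) * (d * k^2 + 1) * x * poly y x"
    unfolding poly_lowering dk by (simp add: d_def)
  have "(x^2 - 1) * poly y x = 0"
    using zero by (simp add: algebra_simps power2_eq_square)
  then consider "poly y x = 0" | "x^2 = 1" by auto
  then show ?thesis
  proof cases
    case 1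
    then have "poly (lowering l n y) x = - d * (x^2 - k^2) * poly (pderiv ([:-1, 0, 1:] * y)) x"
      unfolding r Y' by (simp add: algebra_simps)
    then show ?thesis using d by blast
  next
    case 2
    have e: "d * (1 - k^2) = real n + 1"
      using dk by (simp add: d_def algebra_simps)
    have "poly (lowering l n y) x =
        (d * (1 - k^2) - (d * k^2 + 1)) * ((real n + 1) * x * poly y x)"
      unfolding r 2 by (simp add: algebra_simps)
    also have "\<dots> = - ((2 * l + 1) * (d * (1 - k^2))) * (x * poly y x)"
      unfolding e dk by (simp add: algebra_simps)
    also have "\<dots> = - (d * (2 * l + 1) / 2) * (x^2 - k^2) * poly (pderiv ([:-1, 0, 1:] * y)) x"
      unfolding Y' 2 by (simp add: field_simps)
    finally show ?thesis using d l by (intro exI[of _ "d * (2 * l + 1) / 2"]) simp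
  qed
qed

section \<open>Real zeros and sign changes\<close>

lemma zeros_simple_if_degree_many:
  fixes p :: "'a::idom poly"
  assumes "p \<noteq> 0" and "A \<subseteq> {x. poly p x = 0}" and "degree p \<le> card A"
  shows "{x. poly p x = 0} = A" and "\<And>x. poly p x = 0 \<Longrightarrow> order x p = 1"
proof -
  let ?Z = "{x. poly p x = 0}"
  have fin: "finite ?Z" using assms(1) by (rule poly_roots_finite)
  have bound: "card ?Z \<le> degree p" using assms(1) by (rule card_poly_roots_bound)
  show Z: "?Z = A"
    using card_subset_eq[OF fin assms(2)] card_mono[OF fin assms(2)] assms(3) bound by simp
  fix x assume x: "poly p x = 0"
  have pos: "order z p \<ge> 1" if "z \<in> ?Z" for z
    using that assms(1) order_root[of p z] by auto
  show "order x p = 1"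
  proof (rule ccontr)
    assume "order x p \<noteq> 1"
    then have "(\<Sum>z\<in>?Z. 1) < (\<Sum>z\<in>?Z. order z p)"
      using pos[of x] x by (intro sum_strict_mono_ex1 fin ballI pos bexI[of _ x]) auto
    then show False
      using sum_order_le_degree[OF assms(1)] assms(3) Z by simp
  qed
qed

lemma poly_of_real_map:
  "poly (map_poly of_real p) (of_real x) = (of_real (poly p x) :: 'a::{real_algebra_1,comm_ring_1})"
  by (induction p) (simp_all add: map_poly_pCons)

lemma real_simple_zeros_if_degree_many:
  assumes "p \<noteq> 0" and "A \<subseteq> {x. poly p x = 0}" and "degree p \<le> card A"
  shows "real_simple_zeros p"
proof -
  let ?P = "map_poly complex_of_real p"
  have "?P \<noteq> 0"
    using assms(1) by (simp add: map_poly_eq_0_iff)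
  moreover have "complex_of_real ` A \<subseteq> {z. poly ?P z = 0}"
    using assms(2) by (auto simp: poly_of_real_map)
  moreover have "degree ?P \<le> card (complex_of_real ` A)"
    using assms(3) by (simp add: degree_map_poly card_image inj_on_def)
  ultimately have zeros: "{z. poly ?P z = 0} = complex_of_real ` A"
    and simple: "\<And>z. poly ?P z = 0 \<Longrightarrow> order z ?P = 1"
    by (rule zeros_simple_if_degree_many)+
  have "z \<in> \<real>" if "poly ?P z = 0" for z
  proof -
    have "z \<in> complex_of_real ` A" using that zeros by blast
    then show ?thesis by auto
  qed
  then show ?thesis
    using assms(1) simple by (simp add: real_simple_zeros_def)
qed

text \<open>
  If the derivative were positive at both zeros, the polynomial would be positive just after \<open>a\<close>
  and negative just before \<open>b\<close>, and so would vanish in between. The case of two negative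
  derivatives follows by passing to \<open>- q\<close>.
\<close>

lemma pderiv_alternates_at_consecutive_zeros:
  assumes cz: "consecutive_zeros q a b"
    and "poly (pderiv q) a \<noteq> 0" and "poly (pderiv q) b \<noteq> 0"
  shows "poly (pderiv q) a * poly (pderiv q) b < 0"
proof -
  have False if cz: "consecutive_zeros q a b"
    and pos: "poly (pderiv q) a > 0" "poly (pderiv q) b > 0" for q
  proof -
    have ab: "a < b" and zero: "poly q a = 0" "poly q b = 0"
      and none: "\<And>x. a < x \<Longrightarrow> x < b \<Longrightarrow> poly q x \<noteq> 0"
      using cz by (auto simp: consecutive_zeros_def)
    obtain d1 where "d1 > 0" and d1: "\<And>h. 0 < h \<Longrightarrow> h < d1 \<Longrightarrow> poly q (a + h) > 0"
      using DERIV_pos_inc_right[OF poly_DERIV pos(1)] zero by auto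
    obtain d2 where "d2 > 0" and d2: "\<And>h. 0 < h \<Longrightarrow> h < d2 \<Longrightarrow> poly q (b - h) < 0"
      using DERIV_pos_inc_left[OF poly_DERIV pos(2)] zero by auto
    obtain h where h: "0 < h" "h < min (min d1 d2) ((b - a) / 2)"
      using dense[of 0 "min (min d1 d2) ((b - a) / 2)"] \<open>d1 > 0\<close> \<open>d2 > 0\<close> ab by auto
    then have "a + h < b - h" by (simp add: field_simps)
    then obtain x where "a + h < x" "x < b - h" "poly q x = 0"
      using poly_IVT_neg[of "a + h" "b - h" q] d1[of h] d2[of h] h by auto
    then show False using none[of x] h by auto
  qed
  from this[of q] this[of "- q"] cz assms(2,3) show ?thesis
    by (auto simp: mult_less_0_iff not_less pderiv_minus consecutive_zeros_def)
      (metis linorder_neqE_linordered_idom)+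
qed

lemma grid_interval_exists:
  fixes w :: "nat \<Rightarrow> real"
  assumes "w 0 < x" and "x < w N" and "x \<notin> w ` {0..N}"
  shows "\<exists>i<N. x \<in> {w i<..<w (i + 1)}"
proof -
  obtain m where m: "m \<le> N" "\<forall>i<m. \<not> x < w i" "x < w m"
    using ex_least_nat_le[of "\<lambda>i. x < w i", OF assms(2)] by blast
  then obtain i where i: "m = i + 1"
    using assms(1) by (cases m) auto
  have "w i \<noteq> x" using assms(3) m(1) i by auto
  then have "x \<in> {w i<..<w (i + 1)}" using m(2)[rule_format, of i] m(3) i by auto
  then show ?thesis using i m(1) by (intro exI[of _ i]) auto
qed

lemma grid_interval_unique:
  fixes w :: "nat \<Rightarrow> real"
  assumes "strict_mono_on {0..N} w" and "i < N" and "j < N"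
    and "x \<in> {w i<..<w (i + 1)}" and "x \<in> {w j<..<w (j + 1)}"
  shows "i = j"
proof -
  have mono: "w a \<le> w b" if "a \<le> b" "b \<le> N" for a b
    using strict_mono_on_leD[OF assms(1)] that by auto
  have "\<not> i < j" "\<not> j < i"
    using mono[of "i + 1" j] mono[of "j + 1" i] assms(2-5) by auto
  then show ?thesis by simp
qed

text \<open>
  The pigeonhole part of the argument. An interval containing neither \<open>k\<close> nor \<open>- k\<close> has
  \<open>(w m)^2 - k^2\<close> of the same sign at both ends, hence by assumption a sign change and a zero
  of \<open>p\<close>. This already yields \<open>n\<close> zeros, all that \<open>p\<close> can have; if \<open>k\<close> and \<open>- k\<close> shared an interval there would be \<open>n + 1\<close>.
\<close>

lemma zeros_of_grid_sign_pattern: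
  fixes w :: "nat \<Rightarrow> real" and p :: "real poly"
  assumes mono: "strict_mono_on {0..n + 2} w" and ends: "w 0 = -1" "w (n + 2) = 1"
    and p: "p \<noteq> 0" "degree p = n"
    and k: "0 < k" "k < 1" "\<And>i. i \<le> n + 2 \<Longrightarrow> (w i)^2 \<noteq> k^2"
    and sign: "\<And>i. i \<le> n + 1 \<Longrightarrow> ((w i)^2 - k^2) * ((w (i + 1))^2 - k^2) > 0 \<Longrightarrow>
                  poly p (w i) * poly p (w (i + 1)) < 0"
  obtains i j z where "i \<le> n + 1" "k \<in> {w i<..<w (i + 1)}"
    and "j \<le> n + 1" "- k \<in> {w j<..<w (j + 1)}" and "i \<noteq> j"
    and "{x. poly p x = 0} = z ` ({0..n + 1} - {i, j})"
    and "\<And>m. m \<in> {0..n + 1} - {i, j} \<Longrightarrow> z m \<in> {w m<..<w (m + 1)}"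
    and "real_simple_zeros p" and "\<And>x. poly p x = 0 \<Longrightarrow> order x p = 1"
proof -
  have "w i \<noteq> k \<and> w i \<noteq> - k" if "i \<le> n + 2" for i
    using k(3)[OF that] by auto
  then have "k \<notin> w ` {0..n + 2}" "- k \<notin> w ` {0..n + 2}"
    by (force simp: image_iff)+
  then obtain i j where i: "i < n + 2" "k \<in> {w i<..<w (i + 1)}"
    and j: "j < n + 2" "- k \<in> {w j<..<w (j + 1)}"
    using grid_interval_exists[of w k "n + 2"] grid_interval_exists[of w "- k" "n + 2"] ends k(1,2)
    by auto
  define M where "M = {0..n + 1} - {i, j}"
  have "\<exists>x. x \<in> {w m<..<w (m + 1)} \<and> poly p x = 0" if "m \<in> M" for m
  proof -
    have m: "m \<le> n + 1" "m \<noteq> i" "m \<noteq> j" using that by (auto simp: M_def)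
    have lt: "w m < w (m + 1)" using strict_mono_onD[OF mono, of m "m + 1"] m(1) by simp
    have out: "k \<notin> {w m<..<w (m + 1)}" "- k \<notin> {w m<..<w (m + 1)}"
      using grid_interval_unique[OF mono] i j m by force+
    have ne: "w m \<noteq> k" "w m \<noteq> - k" "w (m + 1) \<noteq> k" "w (m + 1) \<noteq> - k"
      using k(3)[of m] k(3)[of "m + 1"] m(1) by auto
    have fac: "((w m)^2 - k^2) * ((w (m + 1))^2 - k^2) =
        ((w m - k) * (w (m + 1) - k)) * ((w m + k) * (w (m + 1) + k))"
      by (simp add: algebra_simps power2_eq_square)
    have "(w m - k) * (w (m + 1) - k) > 0" "(w m + k) * (w (m + 1) + k) > 0"
      using out ne lt by (auto simp: zero_less_mult_iff)
    then have "((w m)^2 - k^2) * ((w (m + 1))^2 - k^2) > 0"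
      unfolding fac by (rule mult_pos_pos)
    then show ?thesis
      using poly_IVT[OF lt sign[OF m(1)]] by auto
  qed
  then obtain z where z: "\<And>m. m \<in> M \<Longrightarrow> z m \<in> {w m<..<w (m + 1)}"
    and zero: "\<And>m. m \<in> M \<Longrightarrow> poly p (z m) = 0"
    by metis
  have "inj_on z M"
  proof (rule inj_onI)
    fix a b assume ab: "a \<in> M" "b \<in> M" "z a = z b"
    show "a = b"
      by (rule grid_interval_unique[OF mono, of _ _ "z a"]) (use ab z[of a] z[of b] in \<open>auto simp: M_def\<close>)
  qed
  then have card: "card (z ` M) = n + 2 - card {i, j}"
    using i(1) j(1) by (simp add: M_def card_image card_Diff_subset)
  have sub: "z ` M \<subseteq> {x. poly p x = 0}" using zero by auto
  have "card (z ` M) \<le> n"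
    using card_mono[OF poly_roots_finite[OF p(1)] sub] card_poly_roots_bound[OF p(1)] p(2)
    by linarith
  then have ij: "i \<noteq> j" using card by auto
  then have deg: "degree p \<le> card (z ` M)" using card p(2) by simp
  show ?thesis
  proof (rule that[of i j z])
    show "{x. poly p x = 0} = z ` ({0..n + 1} - {i, j})"
      using zeros_simple_if_degree_many(1)[OF p(1) sub deg] by (simp add: M_def)
    show "real_simple_zeros p"
      by (rule real_simple_zeros_if_degree_many[OF p(1) sub deg])
    show "order x p = 1" if "poly p x = 0" for x
      by (rule zeros_simple_if_degree_many(2)[OF p(1) sub deg that])
    show "z m \<in> {w m<..<w (m + 1)}" if "m \<in> {0..n + 1} - {i, j}" for m
      using z that by (simp add: M_def)
  qed (use i j ij in auto)
qed

section \<open>Zeros of ultraspherical polynomials with different parameters\<close>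

theorem theorem4:
  fixes n :: nat and l k :: real and C :: "real \<Rightarrow> nat \<Rightarrow> real poly" and w :: "nat \<Rightarrow> real"
  assumes "n \<ge> 1"
    and "l > -1/2"
    and "ultraspherical_seq l (C l)"
    and "ultraspherical_seq (l + 1) (C (l + 1))"
    and "\<not> (\<exists>x. poly (C (l + 1) (n + 1)) x = 0 \<and> poly (C l n) x = 0)"
    and "w 0 = -1" and "w (n + 2) = 1"
    and "strict_mono_on {0..n + 2} w"
    and "w ` {1..n + 1} = {x. poly (C (l + 1) (n + 1)) x = 0}"
    and "k = sqrt ((real n + 2 * l + 1) / (2 * real n + 2 * l + 2))"
  shows "(\<forall>i\<in>{0..n + 1}.
            ((\<exists>x. {y \<in> {w i<..<w (i + 1)}. poly (C l n) y = 0} = {x} \<and> order x (C l n) = 1) \<or>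
             (k \<in> {w i<..<w (i + 1)} \<or> - k \<in> {w i<..<w (i + 1)})) \<and>
            \<not> ((\<exists>y\<in>{w i<..<w (i + 1)}. poly (C l n) y = 0) \<and>
               (k \<in> {w i<..<w (i + 1)} \<or> - k \<in> {w i<..<w (i + 1)}))) \<and>
         (interlacing (C l n) (C (l + 1) (n + 1)) \<longleftrightarrow> -1 < - k \<and> - k < w 1) \<and>
         (interlacing (C l n) (C (l + 1) (n + 1)) \<longleftrightarrow> w (n + 1) < k \<and> k < 1)"
proof -
  define p y Y where "p = C l n" and "y = C (l + 1) (n + 1)" and "Y = [:-1, 0, 1:] * y"
  note l = assms(2) and w0 = assms(6) and wN = assms(7) and mono = assms(8)
  have p: "p \<noteq> 0" "degree p = n" and y: "y \<noteq> 0" "degree y = n + 1"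
    using assms(3,4) by (auto simp: ultraspherical_seq_def p_def y_def)
  have ode_y: "solves_gegenbauer (l + 1) (n + 1) y"
    unfolding y_def using l by (intro ultraspherical_solves_gegenbauer assms) simp
  have ode_p: "solves_gegenbauer l n p"
    unfolding p_def using l by (intro ultraspherical_solves_gegenbauer assms)
  have zeros_y: "poly y x = 0 \<longleftrightarrow> x \<in> w ` {1..n + 1}" for x
    unfolding assms(9) by (simp add: y_def)
  have lt: "w a < w b" if "a < b" "b \<le> n + 2" for a b
    using strict_mono_onD[OF mono, of a b] that by simp
  have le: "w a \<le> w b" if "a \<le> b" "b \<le> n + 2" for a b
    using strict_mono_on_leD[OF mono, of a b] that by simp
  have frac: "0 < (real n + 2 * l + 1) / (2 * real n + 2 * l + 2)"
    "(real n + 2 * l + 1) / (2 * real n + 2 * l + 2) < 1"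
    using assms(1) l by (auto intro!: divide_pos_pos)
  have k: "0 < k" "k < 1" and k2: "k^2 = (real n + 2 * l + 1) / (2 * real n + 2 * l + 2)"
    using frac by (auto simp: assms(10))

  have ends: "poly y 1 \<noteq> 0" "poly y (-1) \<noteq> 0"
  proof -
    have "w a \<noteq> 1 \<and> w a \<noteq> - 1" if "a \<in> {1..n + 1}" for a
      using lt[of a "n + 2"] lt[of 0 a] w0 wN that by auto
    then have "1 \<notin> w ` {1..n + 1}" "- 1 \<notin> w ` {1..n + 1}"
      by (metis imageE)+
    then show "poly y 1 \<noteq> 0" "poly y (-1) \<noteq> 0" by (auto simp: zeros_y)
  qed
  have "poly (lowering l n y) 1 = - (real n + 1) * (2 * l + 1) * poly y 1"
    by (simp add: poly_lowering algebra_simps)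
  then have "lowering l n y \<noteq> 0"
    using ends(1) l by auto
  then obtain c where c: "p = smult c (lowering l n y)"
    using solves_gegenbauer_unique[OF l ode_p solves_gegenbauer_lowering[OF ode_y]] by blast
  then have c0: "c \<noteq> 0" using p(1) by auto

  have zeros_Y: "poly Y x = 0 \<longleftrightarrow> x \<in> w ` {0..n + 2}" for x
  proof -
    have "poly Y x = (x^2 - 1) * poly y x"
      by (simp add: Y_def algebra_simps power2_eq_square)
    then have "poly Y x = 0 \<longleftrightarrow> x \<in> {-1, 1} \<union> w ` {1..n + 1}"
      by (auto simp: power2_eq_1_iff zeros_y)
    also have "{0..n + 2} = insert 0 (insert (n + 2) {1..n + 1})" by auto
    then have "{-1, 1} \<union> w ` {1..n + 1} = w ` {0..n + 2}"
      using wN by (simp add: w0)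
    finally show ?thesis .
  qed
  (* The common rule for the sign of p at all end points, -1 and 1 included. *)
  have "\<exists>t>0. poly p (w i) = - c * t * ((w i)^2 - k^2) * poly (pderiv Y) (w i)" if "i \<le> n + 2" for i
  proof -
    have "poly Y (w i) = 0" using that by (auto simp: zeros_Y)
    then show ?thesis
      using lowering_at_zero[OF l _ k2, of y "w i"] unfolding c Y_def[symmetric]
      by (auto simp: mult_ac)
  qed
  then obtain t where t: "\<And>i. i \<le> n + 2 \<Longrightarrow> t i > 0"
    and pw: "\<And>i. i \<le> n + 2 \<Longrightarrow> poly p (w i) = - c * t i * ((w i)^2 - k^2) * poly (pderiv Y) (w i)"
    by metis
  (* At the inner end points this is the absence of common zeros. Together with the sign rule it
     also shows that k is no end point and that the zeros of Y are simple. *)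
  have p_nz: "poly p (w i) \<noteq> 0" if "i \<le> n + 2" for i
  proof (cases "i \<in> {1..n + 1}")
    case True
    then show ?thesis using assms(5,9) by (auto simp: p_def)
  next
    case False
    then have "w i = 1 \<or> w i = -1" using that w0 wN by (cases "i = 0"; cases "i = n + 2") auto
    moreover have "poly (pderiv Y) 1 \<noteq> 0" "poly (pderiv Y) (-1) \<noteq> 0"
      using ends by (auto simp: Y_def pderiv_mult pderiv_pCons simp del: mult_pCons_left)
    ultimately show ?thesis
      using pw[OF that] t[OF that] c0 k by (auto simp: power2_eq_1_iff)
  qed
  have wk: "(w i)^2 \<noteq> k^2" and Y'_nz: "poly (pderiv Y) (w i) \<noteq> 0" if "i \<le> n + 2" for i
    using p_nz[OF that] pw[OF that] by auto
  have sign: "poly p (w i) * poly p (w (i + 1)) < 0"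
    if i: "i \<le> n + 1" and pos: "((w i)^2 - k^2) * ((w (i + 1))^2 - k^2) > 0" for i
  proof -
    have "poly Y x \<noteq> 0" if "x \<in> {w i<..<w (i + 1)}" for x
    proof
      assume "poly Y x = 0"
      then obtain m where "m \<le> n + 2" "x = w m" by (auto simp: zeros_Y)
      then show False using that le[of m i] le[of "i + 1" m] i by (cases "m \<le> i") auto
    qed
    moreover have "poly Y (w i) = 0" "poly Y (w (i + 1)) = 0" using i by (auto simp: zeros_Y)
    ultimately have "consecutive_zeros Y (w i) (w (i + 1))"
      using lt[of i "i + 1"] i by (simp add: consecutive_zeros_def)
    then have alt: "poly (pderiv Y) (w i) * poly (pderiv Y) (w (i + 1)) < 0"
      using Y'_nz i by (intro pderiv_alternates_at_consecutive_zeros) auto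
    have "poly p (w i) * poly p (w (i + 1)) =
        (c^2 * (t i * t (i + 1)) * (((w i)^2 - k^2) * ((w (i + 1))^2 - k^2))) *
        (poly (pderiv Y) (w i) * poly (pderiv Y) (w (i + 1)))"
      using i by (simp add: pw power2_eq_square[of c])
    also have "\<dots> < 0"
    proof -
      have "c^2 * (t i * t (i + 1)) > 0" using c0 t[of i] t[of "i + 1"] i by simp
      then show ?thesis by (rule mult_pos_neg[OF mult_pos_pos[OF _ pos] alt])
    qed
    finally show ?thesis .
  qed
  obtain i j z where i: "i \<le> n + 1" "k \<in> {w i<..<w (i + 1)}"
    and j: "j \<le> n + 1" "- k \<in> {w j<..<w (j + 1)}" and ij: "i \<noteq> j"
    and zeros_p: "{x. poly p x = 0} = z ` ({0..n + 1} - {i, j})"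
    and z: "\<And>m. m \<in> {0..n + 1} - {i, j} \<Longrightarrow> z m \<in> {w m<..<w (m + 1)}"
    and simple_p: "real_simple_zeros p" and order_p: "\<And>x. poly p x = 0 \<Longrightarrow> order x p = 1"
    using zeros_of_grid_sign_pattern[OF mono w0 wN p k wk sign] by blast
  have unique: "a = b" if "x \<in> {w a<..<w (a + 1)}" "x \<in> {w b<..<w (b + 1)}" "a \<le> n + 1" "b \<le> n + 1"
    for a b x
    using grid_interval_unique[OF mono _ _ that(1,2)] that(3,4) by simp
  have zero_in: "{x \<in> {w m<..<w (m + 1)}. poly p x = 0} = (if m \<in> {i, j} then {} else {z m})"
    if m: "m \<le> n + 1" for m
  proof -
    have "m \<notin> {i, j} \<and> x = z m" if "x \<in> {w m<..<w (m + 1)}" "poly p x = 0" for x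
    proof -
      have "x \<in> z ` ({0..n + 1} - {i, j})" using that(2) zeros_p by blast
      then obtain a where a: "a \<in> {0..n + 1} - {i, j}" "x = z a" by blast
      then have "a = m" using unique[OF _ that(1) _ m] z[OF a(1)] by auto
      then show ?thesis using a by auto
    qed
    moreover have "poly p (z m) = 0 \<and> z m \<in> {w m<..<w (m + 1)}" if "m \<notin> {i, j}"
      using zeros_p z[of m] m that by auto
    ultimately show ?thesis by auto
  qed
  have k_in: "k \<in> {w m<..<w (m + 1)} \<or> - k \<in> {w m<..<w (m + 1)} \<longleftrightarrow> m \<in> {i, j}" if "m \<le> n + 1" for m
    using unique[OF i(2) _ i(1) that] unique[OF j(2) _ j(1) that] i(2) j(2) by auto

  have sym: "w 1 = - w (n + 1)"
  proof (rule antisym)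
    have *: "w 1 \<le> - w a \<and> - w a \<le> w (n + 1)" if "a \<in> {1..n + 1}" for a
    proof -
      have "poly y (w a) = 0" using that by (auto simp: zeros_y)
      then have "poly y (- w a) = 0"
        using solves_gegenbauer_zeros_symmetric[OF _ ode_y] l by simp
      then obtain b where "b \<in> {1..n + 1}" "- w a = w b" by (auto simp: zeros_y)
      then show ?thesis using le by auto
    qed
    show "w 1 \<le> - w (n + 1)" "- w (n + 1) \<le> w 1"
      using *[of "n + 1"] *[of 1] by auto
  qed
  have j0: "- k < w 1 \<longleftrightarrow> j = 0"
  proof
    assume "- k < w 1"
    then show "j = 0" using unique[OF j(2), of 0] j(1) k w0 by auto
  qed (use j(2) in auto)
  have i0: "w (n + 1) < k \<longleftrightarrow> i = n + 1"
  proof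
    assume "w (n + 1) < k"
    then show "i = n + 1" using unique[OF i(2), of "n + 1"] i(1) k wN by auto
  qed (use i(2) in auto)
  (* Interlacing forces the two intervals without a zero, namely those of k and -k, to be the two
     outer ones; -k lies to the left of k. *)
  have "interlacing p y \<longleftrightarrow> j = 0 \<and> i = n + 1"
  proof
    assume inter: "interlacing p y"
    have "m \<notin> {i, j}" if m: "m \<in> {1..n}" for m
    proof -
      have "consecutive_zeros y (w m) (w (m + 1))"
        unfolding consecutive_zeros_def
      proof (intro conjI ballI)
        show "w m < w (m + 1)" using lt[of m "m + 1"] m by auto
        show "poly y (w m) = 0" "poly y (w (m + 1)) = 0" using m by (auto simp: zeros_y)
        fix x assume x: "x \<in> {w m<..<w (m + 1)}"
        show "poly y x \<noteq> 0"
        proof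
          assume "poly y x = 0"
          then obtain a where "a \<in> {1..n + 1}" "x = w a" by (auto simp: zeros_y)
          then show False using x le[of a m] le[of "m + 1" a] m by (cases "a \<le> m") auto
        qed
      qed
      then obtain x where "x \<in> {w m<..<w (m + 1)}" "poly p x = 0"
        using inter unfolding interlacing_def by blast
      then show ?thesis using zero_in[of m] m by (auto split: if_splits)
    qed
    then have "i \<notin> {1..n}" "j \<notin> {1..n}" by blast+
    then have "i \<in> {0, n + 1}" "j \<in> {0, n + 1}" using i(1) j(1) by auto
    moreover have "\<not> i < j"
      using i(2) j(2) le[of "i + 1" j] j(1) k(1) by auto
    ultimately show "j = 0 \<and> i = n + 1" using ij by auto
  next
    assume ji: "j = 0 \<and> i = n + 1"
    have "real_simple_zeros y"
    proof (rule real_simple_zeros_if_degree_many[OF y(1)])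
      have "inj_on w {1..n + 1}"
        using strict_mono_on_imp_inj_on[OF mono] by (rule inj_on_subset) auto
      then show "degree y \<le> card (w ` {1..n + 1})" using y(2) by (simp add: card_image)
    qed (auto simp: zeros_y)
    moreover have "\<exists>!x. x \<in> {a<..<b} \<and> poly p x = 0" if ab: "consecutive_zeros y a b" for a b
    proof -
      obtain m q where m: "m \<in> {1..n + 1}" "a = w m" and q: "q \<in> {1..n + 1}" "b = w q"
        using ab by (auto simp: consecutive_zeros_def zeros_y)
      have "m < q" using ab le[of q m] m q by (cases "m < q") (auto simp: consecutive_zeros_def)
      have "\<not> m + 1 < q"
      proof
        assume "m + 1 < q"
        then have "w (m + 1) \<in> {a<..<b}" "poly y (w (m + 1)) = 0"
          using lt[of m "m + 1"] lt[of "m + 1" q] m q by (auto simp: zeros_y)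
        then show False using ab by (auto simp: consecutive_zeros_def)
      qed
      with \<open>m < q\<close> have "q = m + 1" by simp
      moreover have "m \<notin> {i, j}" using m q(1) \<open>q = m + 1\<close> ji by auto
      ultimately have eq: "{x \<in> {a<..<b}. poly p x = 0} = {z m}"
        using zero_in[of m] m q by simp
      have "x \<in> {a<..<b} \<and> poly p x = 0 \<longleftrightarrow> x \<in> {x \<in> {a<..<b}. poly p x = 0}" for x
        by (rule mem_Collect_eq[symmetric])
      then show ?thesis unfolding eq singleton_iff by simp
    qed
    ultimately show "interlacing p y"
      using p(2) y(2) simple_p by (simp add: interlacing_def)
  qed
  then have inter: "interlacing p y \<longleftrightarrow> - k < w 1" "interlacing p y \<longleftrightarrow> w (n + 1) < k"
    using sym i0 j0 by auto
  show ?thesis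
    unfolding p_def[symmetric] y_def[symmetric]
  proof (intro conjI ballI)
    fix m assume "m \<in> {0..n + 1}"
    then have m: "m \<le> n + 1" by simp
    show "(\<exists>x. {y \<in> {w m<..<w (m + 1)}. poly p y = 0} = {x} \<and> order x p = 1) \<or>
        (k \<in> {w m<..<w (m + 1)} \<or> - k \<in> {w m<..<w (m + 1)})"
    proof (cases "m \<in> {i, j}")
      case False
      have eq: "{x \<in> {w m<..<w (m + 1)}. poly p x = 0} = {z m}"
        using zero_in[OF m] False by simp
      have "z m \<in> {x \<in> {w m<..<w (m + 1)}. poly p x = 0}"
        unfolding eq by (rule singletonI)
      then have "order (z m) p = 1" by (intro order_p) simp
      then show ?thesis using eq by (intro disjI1 exI conjI)
    qed (use k_in[OF m] in blast)
    show "\<not> ((\<exists>y\<in>{w m<..<w (m + 1)}. poly p y = 0) \<and>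
        (k \<in> {w m<..<w (m + 1)} \<or> - k \<in> {w m<..<w (m + 1)}))"
    proof (cases "m \<in> {i, j}")
      case True
      then have "{x \<in> {w m<..<w (m + 1)}. poly p x = 0} = {}"
        using zero_in[OF m] by simp
      then show ?thesis by blast
    qed (use k_in[OF m] in blast)
  qed (use inter k in simp_all)
qed

end
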